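(* Let $\mathcal{X},\mathcal{U},\mathcal{W}$ be finite nonempty sets, $\beta_1,\beta_2>0$, $\rho_t:\mathcal{X}\times\mathcal{U}\times\mathcal{W}\to\mathbb{R}$ a function and $x_t\in\mathcal{X}$ a fixed state. Consider the one-shot game in which player 1 chooses $\sigma_t=\sigma_t(\cdot|x_t)\in\Delta(\mathcal{U})$ to maximize, and player 2 chooses $\tau_t=\tau_t(\cdot|x_t)\in\Delta(\mathcal{W})$ to minimize, $$\mathcal{V}_t^{\sigma_t,\tau_t}(x_t)=\mathbb{E}^{\sigma_t,\tau_t}\Big[\rho_t(x_t,u_t,w_t)-\frac1{\beta_1}\log\sigma_t(u_t|x_t)+\frac1{\beta_2}\log\tau_t(w_t|x_t)\Big].$$ Then optimal strategies $(\sigma_t^\star,\tau_t^\star)$ satisfy $$\sigma_t^\star(\cdot|x_t)\in\arg\max_{\sigma_t\in\Delta(\mathcal{U})}\Big[-\frac1{\beta_1}\sum_{u_t\in\mathcal{U}}\sigma_t(u_t|x_t)\log\sigma_t(u_t|x_t)-\frac1{\beta_2}\log\sum_{w_t\in\mathcal{W}}\exp\Big(-\beta_2\sum_{u_t\in\mathcal{U}}\sigma_t(u_t|x_t)\rho_t(x_t,u_t,w_t)\Big)\Big],$$ $$\tau_t^\star(w_t|x_t)=\frac{\exp\big(-\beta_2\sum_{u_t\in\mathcal{U}}\sigma_t^\star(u_t|x_t)\rho_t(x_t,u_t,w_t)\big)}{\sum_{w\in\mathcal{W}}\exp\big(-\beta_2\sum_{u_t\in\mathcal{U}}\sigma_t^\star(u_t|x_t)\rho_t(x_t,u_t,w)\big)}\qquad\text{for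 all } w_t\in\mathcal{W}.$$ Furthermore, the unique value $\mathcal{V}_t^\star(x_t)$ of the game is given by $$\mathcal{V}_t^\star(x_t)=-\frac1{\beta_1}\sum_{u_t\in\mathcal{U}}\sigma_t^\star(u_t|x_t)\log\sigma_t^\star(u_t|x_t)-\frac1{\beta_2}\log\sum_{w_t\in\mathcal{W}}\exp\Big(-\beta_2\sum_{u_t\in\mathcal{U}}\sigma_t^\star(u_t|x_t)\rho_t(x_t,u_t,w_t)\Big).$$
   Context: $\Delta(S)$ is the probability simplex over a finite set $S$. The expectation $\mathbb{E}^{\sigma_t,\tau_t}$ is over independent $u_t\sim\sigma_t(\cdot|x_t)$ and $w_t\sim\tau_t(\cdot|x_t)$; $\log$ is the natural logarithm and $0\log 0=0$. The value of the game is the common number $\max_{\sigma_t}\min_{\tau_t}\mathcal{V}_t^{\sigma_t,\tau_t}(x_t)=\min_{\tau_t}\max_{\sigma_t}\mathcal{V}_t^{\sigma_t,\tau_t}(x_t)$. Optimal (equilibrium) strategies $(\sigma_t^\star,\tau_t^\star)$ are a pair attaining the value, i.e. a saddle point: $\mathcal{V}_t^{\sigma_t,\tau_t^\star}(x_t)\le\mathcal{V}_t^{\sigma_t^\star,\tau_t^\star}(x_t)\le\mathcal{V}_t^{\sigma_t^\star,\tau_t}(x_t)$ for all $\sigma_t\in\Delta(\mathcal{U})$, $\tau_t\in\Delta(\mathcal{W})$. *)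

theory Defs
  imports "HOL-Probability.Probability"
begin

definition prob_simplex :: "'a set \<Rightarrow> 'a pmf set" where
  "prob_simplex S = {p. set_pmf p \<subseteq> S}"

text \<open>The convention \<open>0 log 0 = 0\<close> needs no special treatment in what follows: a logarithm of a
  zero probability only ever occurs with weight zero.\<close>

definition entropic_payoff ::
    "real \<Rightarrow> real \<Rightarrow> ('x \<Rightarrow> 'u \<Rightarrow> 'w \<Rightarrow> real) \<Rightarrow> 'x \<Rightarrow> 'u pmf \<Rightarrow> 'w pmf \<Rightarrow> real" where
  "entropic_payoff \<beta>1 \<beta>2 \<rho> x \<sigma> \<tau> =
     measure_pmf.expectation (pair_pmf \<sigma> \<tau>)
       (\<lambda>(u, w). \<rho> x u w - (1 / \<beta>1) * ln (pmf \<sigma> u) + (1 / \<beta>2) * ln (pmf \<tau> w))"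

definition saddle_point ::
    "('a \<Rightarrow> 'b \<Rightarrow> real) \<Rightarrow> 'a set \<Rightarrow> 'b set \<Rightarrow> 'a \<Rightarrow> 'b \<Rightarrow> bool" where
  "saddle_point f A B a b \<longleftrightarrow>
     a \<in> A \<and> b \<in> B \<and> (\<forall>a'\<in>A. f a' b \<le> f a b) \<and> (\<forall>b'\<in>B. f a b \<le> f a b')"

text \<open>Maxima and minima are relations between a function and a number, so that stating one
  includes that it is attained.\<close>

definition is_max_value :: "('a \<Rightarrow> real) \<Rightarrow> 'a set \<Rightarrow> real \<Rightarrow> bool" where
  "is_max_value f A m \<longleftrightarrow> (\<exists>a. is_arg_max f (\<lambda>a. a \<in> A) a \<and> f a = m)"

definition is_min_value :: "('a \<Rightarrow> real) \<Rightarrow> 'a set \<Rightarrow> real \<Rightarrow> bool" where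
  "is_min_value f A m \<longleftrightarrow> (\<exists>a. is_arg_min f (\<lambda>a. a \<in> A) a \<and> f a = m)"

definition is_maxmin :: "('a \<Rightarrow> 'b \<Rightarrow> real) \<Rightarrow> 'a set \<Rightarrow> 'b set \<Rightarrow> real \<Rightarrow> bool" where
  "is_maxmin f A B v \<longleftrightarrow>
     (\<exists>g. (\<forall>a\<in>A. is_min_value (\<lambda>b. f a b) B (g a)) \<and> is_max_value g A v)"

definition is_minmax :: "('a \<Rightarrow> 'b \<Rightarrow> real) \<Rightarrow> 'a set \<Rightarrow> 'b set \<Rightarrow> real \<Rightarrow> bool" where
  "is_minmax f A B v \<longleftrightarrow>
     (\<exists>g. (\<forall>b\<in>B. is_max_value (\<lambda>a. f a b) A (g b)) \<and> is_min_value g B v)"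

definition is_game_value :: "('a \<Rightarrow> 'b \<Rightarrow> real) \<Rightarrow> 'a set \<Rightarrow> 'b set \<Rightarrow> real \<Rightarrow> bool" where
  "is_game_value f A B v \<longleftrightarrow> is_maxmin f A B v \<and> is_minmax f A B v"

end

theory Submission
  imports Defs "HOL-Real_Asymp.Real_Asymp"
begin

text \<open>
  Against a fixed strategy \<open>\<sigma>\<close> of player 1, player 2 faces a linear cost plus a scaled negative
  entropy. Up to the factor \<open>1 / \<beta>2\<close>, the excess of this functional over
  \<open>- (1 / \<beta>2) ln (\<Sum>w. exp (- \<beta>2 c w))\<close> is the relative entropy of \<open>\<tau>\<close> with respect to the
  Boltzmann distribution of the cost \<open>c w = (\<Sum>u. \<sigma> u \<rho> x u w)\<close>. By Gibbs' inequality that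
  excess is nonnegative and vanishes only at the Boltzmann distribution
  (\<open>free_energy_ge_soft_min\<close>, \<open>free_energy_eq_imp_boltzmann\<close>). So the best reply of player 2 is
  unique and explicit, and substituting it leaves player 1 with maximising \<open>guaranteed_payoff\<close>.
  The form of any saddle point and of the value follow at once.

  What remains is that a saddle point exists. The guaranteed payoff is continuous, so it has a
  maximiser \<open>s\<close> on the compact simplex; let \<open>t\<close> be the Boltzmann reply to \<open>s\<close>. For a deviation
  \<open>\<sigma>\<close> let \<open>t\<^sub>\<epsilon>\<close> be the reply to the mixture \<open>(1 - \<epsilon>) s + \<epsilon> \<sigma>\<close>. The payoff is concave in
  the first strategy, so the payoff of the mixture against \<open>t\<^sub>\<epsilon>\<close>, which is at most the maximum
  \<open>M\<close> of the guaranteed payoff, is at least \<open>(1 - \<epsilon>) M\<close> plus \<open>\<epsilon>\<close> times the payoff of \<open>\<sigma>\<close>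
  against \<open>t\<^sub>\<epsilon>\<close>. Hence the latter is at most \<open>M\<close>, and since \<open>t\<^sub>\<epsilon>\<close> tends to \<open>t\<close> as
  \<open>\<epsilon>\<close> tends to 0, no deviation \<open>\<sigma>\<close> from \<open>s\<close> pays against \<open>t\<close>
  (\<open>no_profitable_deviation\<close>). The uniqueness of the best
  reply thus takes the place of a minimax theorem.
\<close>

section \<open>Distributions on a finite set\<close>

lemma pmf_eq_0_outside_simplex:
  assumes "p \<in> prob_simplex A" "a \<notin> A"
  shows "pmf p a = 0"
  using assms by (auto simp: prob_simplex_def set_pmf_eq)

lemma sum_pmf_prob_simplex:
  assumes "finite A" "p \<in> prob_simplex A"
  shows "(\<Sum>a\<in>A. pmf p a) = 1"
  using assms by (intro sum_pmf_eq_1) (auto simp: prob_simplex_def)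

lemma prob_simplex_of_weights:
  fixes f :: "'a \<Rightarrow> real"
  assumes A: "finite A" and nonneg: "\<And>a. a \<in> A \<Longrightarrow> f a \<ge> 0" and total: "(\<Sum>a\<in>A. f a) = 1"
  obtains p where "p \<in> prob_simplex A" and "\<forall>a\<in>A. pmf p a = f a"
proof -
  define g where "g = (\<lambda>a. if a \<in> A then f a else 0)"
  have g_nonneg: "g a \<ge> 0" for a
    using nonneg by (auto simp: g_def)
  have "(\<integral>\<^sup>+ a. ennreal (g a) \<partial>count_space UNIV) = (\<Sum>a\<in>A. ennreal (g a))"
    using A by (intro nn_integral_count_space') (auto simp: g_def)
  also have "\<dots> = ennreal (\<Sum>a\<in>A. g a)"
    using g_nonneg by (intro sum_ennreal) auto
  also have "(\<Sum>a\<in>A. g a) = 1"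
    using total by (simp add: g_def)
  finally have pmf_g: "pmf (embed_pmf g) a = g a" for a
    using g_nonneg by (intro pmf_embed_pmf) auto
  show thesis
  proof
    show "embed_pmf g \<in> prob_simplex A"
      by (auto simp: prob_simplex_def set_pmf_eq pmf_g) (auto simp: g_def split: if_splits)
    show "\<forall>a\<in>A. pmf (embed_pmf g) a = f a"
      unfolding pmf_g by (simp add: g_def)
  qed
qed

lemma prob_simplex_mixture:
  assumes "p \<in> prob_simplex A" "q \<in> prob_simplex A" and e: "0 \<le> e" "e \<le> 1"
  obtains r where "r \<in> prob_simplex A" and "\<forall>a. pmf r a = (1 - e) * pmf p a + e * pmf q a"
proof
  let ?r = "bernoulli_pmf e \<bind> (\<lambda>b. if b then q else p)"
  show "?r \<in> prob_simplex A"
    using assms by (auto simp: prob_simplex_def split: if_splits)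
  show "\<forall>a. pmf ?r a = (1 - e) * pmf p a + e * pmf q a"
    using e by (simp add: pmf_bind algebra_simps)
qed

text \<open>The simplex, seen as a set of real-valued functions, is closed in a product of compact
  sets.\<close>

lemma compact_weight_simplex:
  fixes A :: "'a set"
  assumes "finite A"
  shows "compact {f :: 'a \<Rightarrow> real. (\<forall>a. f a \<in> (if a \<in> A then {0..1} else {0})) \<and> (\<Sum>a\<in>A. f a) = 1}"
proof -
  let ?B = "PiE UNIV (\<lambda>a. if a \<in> A then {0..1::real} else {0})"
  have "compactin (product_topology (\<lambda>a::'a. euclidean :: real topology) UNIV) ?B"
    by (subst compactin_PiE) auto
  hence "compact ?B"
    by (simp add: euclidean_product_topology)
  moreover have "closed {f :: 'a \<Rightarrow> real. (\<Sum>a\<in>A. f a) = 1}"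
    by (intro closed_Collect_eq continuous_intros continuous_on_product_coordinates)
  ultimately have "compact (?B \<inter> {f. (\<Sum>a\<in>A. f a) = 1})"
    by (rule compact_Int_closed)
  also have "?B \<inter> {f. (\<Sum>a\<in>A. f a) = 1} =
      {f. (\<forall>a. f a \<in> (if a \<in> A then {0..1} else {0})) \<and> (\<Sum>a\<in>A. f a) = 1}"
    by (auto simp: PiE_def Pi_def)
  finally show ?thesis .
qed

lemma continuous_attains_max_prob_simplex:
  fixes F :: "('a \<Rightarrow> real) \<Rightarrow> real"
  assumes A: "finite A" "A \<noteq> {}"
    and cont: "continuous_on {f. \<forall>a. f a \<ge> 0} F"
  obtains p where "p \<in> prob_simplex A" and "\<forall>q\<in>prob_simplex A. F (pmf q) \<le> F (pmf p)"
proof -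
  let ?K = "{f :: 'a \<Rightarrow> real. (\<forall>a. f a \<in> (if a \<in> A then {0..1} else {0})) \<and> (\<Sum>a\<in>A. f a) = 1}"
  have pmf_in_K: "pmf q \<in> ?K" if "q \<in> prob_simplex A" for q
    using that A by (auto simp: pmf_le_1 pmf_eq_0_outside_simplex sum_pmf_prob_simplex)
  obtain a where "a \<in> A" using A by auto
  hence "return_pmf a \<in> prob_simplex A" by (auto simp: prob_simplex_def)
  hence ne: "?K \<noteq> {}" using pmf_in_K by blast
  have "?K \<subseteq> {f. \<forall>a. f a \<ge> 0}"
  proof safe
    fix f b assume "\<forall>a. f a \<in> (if a \<in> A then {0..1} else {0::real})"
    thus "0 \<le> f b" by (cases "b \<in> A") (auto dest: spec[of _ b])
  qed
  then obtain f where f: "f \<in> ?K" and max: "\<forall>g\<in>?K. F g \<le> F f"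
    using continuous_attains_sup[OF compact_weight_simplex[OF A(1)] ne
        continuous_on_subset[OF cont]] by blast
  have f_box: "f a \<in> (if a \<in> A then {0..1} else {0})" for a using f by blast
  have f_nonneg: "f a \<ge> 0" if "a \<in> A" for a using f_box[of a] that by simp
  have f_total: "sum f A = 1" using f by blast
  obtain p where p: "p \<in> prob_simplex A" "\<forall>a\<in>A. pmf p a = f a"
    using prob_simplex_of_weights[OF A(1) f_nonneg f_total] by blast
  have "pmf p = f"
  proof
    fix a show "pmf p a = f a"
      using p f_box[of a] pmf_eq_0_outside_simplex[OF p(1), of a] by (cases "a \<in> A") auto
  qed
  with max pmf_in_K p(1) show thesis by (intro that) auto
qed

section \<open>Entropy and the Boltzmann distribution\<close>

text \<open>The graph of \<open>t \<mapsto> t ln t\<close> lies strictly above its tangent at \<open>m\<close>, except at \<open>m\<close>. Summed,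
  this is Gibbs' inequality; averaged, it is the concavity of entropy.\<close>

lemma xlnx_ge_tangent:
  fixes t m :: real
  assumes "t \<ge> 0" "m > 0"
  shows "t - m \<le> t * ln t - t * ln m"
proof (cases "t = 0")
  case False
  with assms have "t > 0" by simp
  hence "ln (m / t) \<le> m / t - 1" using assms by (intro ln_le_minus_one) auto
  hence "t * ln (m / t) \<le> t * (m / t - 1)" using \<open>t > 0\<close> by (intro mult_left_mono) auto
  thus ?thesis using \<open>t > 0\<close> assms by (simp add: ln_div algebra_simps)
qed (use assms in auto)

lemma xlnx_eq_tangent_imp_eq:
  fixes t m :: real
  assumes "t \<ge> 0" "m > 0" and eq: "t * ln t - t * ln m = t - m"
  shows "t = m"
proof (cases "t = 0")
  case False
  with assms have "t > 0" by simp
  have "t * ln (m / t) = t * (m / t - 1)"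
    using eq \<open>t > 0\<close> assms by (simp add: ln_div algebra_simps)
  hence "ln (m / t) = m / t - 1" using \<open>t > 0\<close> by simp
  hence "m / t = 1" using \<open>t > 0\<close> assms by (intro ln_eq_minus_one) auto
  thus ?thesis using \<open>t > 0\<close> by simp
qed (use assms in auto)

lemma xlnx_convex:
  fixes a b e :: real
  assumes "a \<ge> 0" "b \<ge> 0" "0 < e" "e < 1"
  shows "((1 - e) * a + e * b) * ln ((1 - e) * a + e * b) \<le> (1 - e) * (a * ln a) + e * (b * ln b)"
proof (cases "a = 0 \<and> b = 0")
  case False
  let ?m = "(1 - e) * a + e * b"
  have m: "?m > 0"
    using False assms
    by (metis add_nonneg_pos add_pos_nonneg diff_gt_0_iff_gt less_eq_real_def mult_nonneg_nonneg mult_pos_pos)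
  have "(1 - e) * (a - ?m) \<le> (1 - e) * (a * ln a - a * ln ?m)"
    using assms m by (intro mult_left_mono xlnx_ge_tangent) auto
  moreover have "e * (b - ?m) \<le> e * (b * ln b - b * ln ?m)"
    using assms m by (intro mult_left_mono xlnx_ge_tangent) auto
  moreover have "(1 - e) * (a - ?m) + e * (b - ?m) = 0"
    by (simp add: algebra_simps)
  ultimately show ?thesis by (simp add: algebra_simps)
qed auto

lemma continuous_on_xlnx: "continuous_on {0..} (\<lambda>t::real. t * ln t)"
  unfolding continuous_on_eq_continuous_within
proof
  fix t :: real assume "t \<in> {0..}"
  show "continuous (at t within {0..}) (\<lambda>t. t * ln t)"
  proof (cases "t = 0")
    case True
    have "((\<lambda>t::real. t * ln t) \<longlongrightarrow> 0) (at_right 0)" by real_asymp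
    moreover have "{0..} - {0} = {0<..} - {0::real}"
      by auto
    hence "at 0 within {0..} = at_right (0::real)"
      by (simp only: at_within_def)
    ultimately show ?thesis using True by (simp add: continuous_within)
  next
    case False
    thus ?thesis by (intro continuous_intros) auto
  qed
qed

definition soft_min :: "real \<Rightarrow> 'a set \<Rightarrow> ('a \<Rightarrow> real) \<Rightarrow> real" where
  "soft_min \<beta> A c = - (1 / \<beta>) * ln (\<Sum>a\<in>A. exp (- \<beta> * c a))"

definition boltzmann :: "real \<Rightarrow> 'a set \<Rightarrow> ('a \<Rightarrow> real) \<Rightarrow> 'a \<Rightarrow> real" where
  "boltzmann \<beta> A c a = exp (- \<beta> * c a) / (\<Sum>b\<in>A. exp (- \<beta> * c b))"

definition free_energy :: "real \<Rightarrow> 'a set \<Rightarrow> ('a \<Rightarrow> real) \<Rightarrow> 'a pmf \<Rightarrow> real" where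
  "free_energy \<beta> A c p = (\<Sum>a\<in>A. pmf p a * c a) + (1 / \<beta>) * (\<Sum>a\<in>A. pmf p a * ln (pmf p a))"

lemma partition_function_pos:
  fixes c :: "'a \<Rightarrow> real"
  assumes "finite A" "A \<noteq> {}"
  shows "(\<Sum>a\<in>A. exp (- \<beta> * c a)) > 0"
  using assms by (intro sum_pos) auto

lemma boltzmann_pos:
  assumes "finite A" "A \<noteq> {}"
  shows "boltzmann \<beta> A c a > 0"
  using partition_function_pos[OF assms] by (simp add: boltzmann_def)

lemma sum_boltzmann:
  assumes "finite A" "A \<noteq> {}"
  shows "(\<Sum>a\<in>A. boltzmann \<beta> A c a) = 1"
  using partition_function_pos[OF assms, of \<beta> c]
  by (simp add: boltzmann_def flip: sum_divide_distrib)

lemma tendsto_boltzmann: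
  assumes "finite A" "A \<noteq> {}" "\<And>a. ((\<lambda>e. c e a) \<longlongrightarrow> d a) F"
  shows "((\<lambda>e. boltzmann \<beta> A (c e) a) \<longlongrightarrow> boltzmann \<beta> A d a) F"
  unfolding boltzmann_def
  using partition_function_pos[OF assms(1,2), of \<beta> d]
  by (intro tendsto_intros assms) auto

text \<open>Since \<open>ln (boltzmann \<beta> A c a)\<close> is \<open>- \<beta> * c a\<close> up to a constant, the excess of the free energy
  over the soft minimum is a relative entropy. The terms \<open>- p + q\<close> added here sum to zero and
  make every summand nonnegative.\<close>

lemma free_energy_excess:
  fixes c :: "'a \<Rightarrow> real"
  assumes A: "finite A" "A \<noteq> {}" and \<beta>: "\<beta> > 0" and p: "p \<in> prob_simplex A"
  defines "q \<equiv> boltzmann \<beta> A c"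
  shows "free_energy \<beta> A c p - soft_min \<beta> A c =
    (1 / \<beta>) * (\<Sum>a\<in>A. (pmf p a * ln (pmf p a) - pmf p a * ln (q a)) - (pmf p a - q a))"
proof -
  let ?Z = "\<Sum>a\<in>A. exp (- \<beta> * c a)"
  have Z: "?Z > 0" by (rule partition_function_pos[OF A])
  have ln_q: "ln (q a) = - \<beta> * c a - ln ?Z" for a
    using Z by (simp add: q_def boltzmann_def ln_div)
  have sums: "(\<Sum>a\<in>A. pmf p a) = 1" "(\<Sum>a\<in>A. q a) = 1"
    using A p by (auto simp: sum_pmf_prob_simplex q_def sum_boltzmann)
  have "(\<Sum>a\<in>A. (pmf p a * ln (pmf p a) - pmf p a * ln (q a)) - (pmf p a - q a)) =
      (\<Sum>a\<in>A. pmf p a * ln (pmf p a)) - (\<Sum>a\<in>A. pmf p a * ln (q a))"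
    by (simp add: sum_subtractf sums)
  also have "(\<Sum>a\<in>A. pmf p a * ln (q a)) = - \<beta> * (\<Sum>a\<in>A. pmf p a * c a) - (\<Sum>a\<in>A. pmf p a) * ln ?Z"
    unfolding ln_q sum_distrib_left sum_distrib_right
    by (simp add: right_diff_distrib sum_subtractf mult_ac sum_negf)
  finally show ?thesis
    using \<beta> by (simp add: sums free_energy_def soft_min_def field_simps)
qed

lemma free_energy_ge_soft_min:
  assumes "finite A" "A \<noteq> {}" "\<beta> > 0" "p \<in> prob_simplex A"
  shows "soft_min \<beta> A c \<le> free_energy \<beta> A c p"
proof -
  have "0 \<le> (pmf p a * ln (pmf p a) - pmf p a * ln (boltzmann \<beta> A c a))
      - (pmf p a - boltzmann \<beta> A c a)" for a
    using xlnx_ge_tangent[OF pmf_nonneg boltzmann_pos[OF assms(1,2)], of p a \<beta> c a] by simp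
  hence "0 \<le> (1 / \<beta>) * (\<Sum>a\<in>A. (pmf p a * ln (pmf p a) - pmf p a * ln (boltzmann \<beta> A c a))
      - (pmf p a - boltzmann \<beta> A c a))"
    using assms by (intro mult_nonneg_nonneg sum_nonneg) auto
  thus ?thesis using free_energy_excess[OF assms, of c] by linarith
qed

lemma free_energy_eq_imp_boltzmann:
  assumes A: "finite A" "A \<noteq> {}" and \<beta>: "\<beta> > 0" and p: "p \<in> prob_simplex A"
    and eq: "free_energy \<beta> A c p = soft_min \<beta> A c" and "a \<in> A"
  shows "pmf p a = boltzmann \<beta> A c a"
proof -
  let ?d = "\<lambda>a. (pmf p a * ln (pmf p a) - pmf p a * ln (boltzmann \<beta> A c a))
    - (pmf p a - boltzmann \<beta> A c a)"
  have "0 \<le> ?d b" for b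
    using xlnx_ge_tangent[OF pmf_nonneg boltzmann_pos[OF A], of p b \<beta> c b] by simp
  moreover have "sum ?d A = 0"
    using free_energy_excess[OF A \<beta> p, of c] eq \<beta> by simp
  ultimately have "?d a = 0"
    using A(1) \<open>a \<in> A\<close> by (intro sum_nonneg_0[of A ?d]) auto
  thus ?thesis
    using xlnx_eq_tangent_imp_eq[OF pmf_nonneg boltzmann_pos[OF A], of p a \<beta> c a] by simp
qed

lemma boltzmann_attains_soft_min:
  assumes A: "finite A" "A \<noteq> {}" and \<beta>: "\<beta> > 0"
  obtains p where "p \<in> prob_simplex A" "\<forall>a\<in>A. pmf p a = boltzmann \<beta> A c a"
    "free_energy \<beta> A c p = soft_min \<beta> A c"
proof -
  obtain p where p: "p \<in> prob_simplex A" "\<forall>a\<in>A. pmf p a = boltzmann \<beta> A c a"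
    using prob_simplex_of_weights[of A "boltzmann \<beta> A c", OF A(1)
        less_imp_le[OF boltzmann_pos[OF A]] sum_boltzmann[OF A]] by blast
  have "free_energy \<beta> A c p - soft_min \<beta> A c = 0"
    unfolding free_energy_excess[OF A \<beta> p(1)] using p by simp
  with p show thesis by (intro that[of p]) auto
qed

section \<open>Saddle points and values of abstract games\<close>

lemma is_max_value_iff:
  "is_max_value f A m \<longleftrightarrow> (\<exists>a\<in>A. f a = m) \<and> (\<forall>a\<in>A. f a \<le> m)"
  unfolding is_max_value_def is_arg_max_def by (fastforce simp: not_less)

lemma is_min_value_iff:
  "is_min_value f A m \<longleftrightarrow> (\<exists>a\<in>A. f a = m) \<and> (\<forall>a\<in>A. m \<le> f a)"
  unfolding is_min_value_def is_arg_min_def by (fastforce simp: not_less)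

text \<open>A saddle point alone does not give a max-min and a min-max: these also ask for an optimal reply
  to every strategy, not only to those of the saddle point. The last two hypotheses supply it.\<close>

lemma saddle_point_imp_game_value:
  assumes sp: "saddle_point f A B a b"
    and min_B: "\<And>a'. a' \<in> A \<Longrightarrow> \<exists>v. is_min_value (f a') B v"
    and max_A: "\<And>b'. b' \<in> B \<Longrightarrow> \<exists>v. is_max_value (\<lambda>a'. f a' b') A v"
  shows "is_game_value f A B (f a b)"
proof -
  have ab: "a \<in> A" "b \<in> B" and a: "\<And>a'. a' \<in> A \<Longrightarrow> f a' b \<le> f a b"
    and b: "\<And>b'. b' \<in> B \<Longrightarrow> f a b \<le> f a b'"
    using sp by (auto simp: saddle_point_def)
  obtain g where g: "\<And>a'. a' \<in> A \<Longrightarrow> is_min_value (f a') B (g a')"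
    using min_B by metis
  have g_le: "g a' \<le> f a' b'" if "a' \<in> A" "b' \<in> B" for a' b'
    using g[OF that(1)] that(2) by (simp add: is_min_value_iff)
  have "f a b \<le> g a"
    using g[OF ab(1)] b unfolding is_min_value_iff by metis
  hence "g a = f a b" using g_le[OF ab] by simp
  moreover have "g a' \<le> f a b" if "a' \<in> A" for a'
    using g_le[OF that ab(2)] a[OF that] by (rule order.trans)
  ultimately have "is_max_value g A (f a b)"
    unfolding is_max_value_iff using ab by blast
  hence maxmin: "is_maxmin f A B (f a b)"
    unfolding is_maxmin_def using g by blast
  obtain h where h: "\<And>b'. b' \<in> B \<Longrightarrow> is_max_value (\<lambda>a'. f a' b') A (h b')"
    using max_A by metis
  have h_ge: "f a' b' \<le> h b'" if "a' \<in> A" "b' \<in> B" for a' b'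
    using h[OF that(2)] that(1) by (simp add: is_max_value_iff)
  have "h b \<le> f a b"
    using h[OF ab(2)] a unfolding is_max_value_iff by metis
  hence "h b = f a b" using h_ge[OF ab] by simp
  moreover have "f a b \<le> h b'" if "b' \<in> B" for b'
    using b[OF that] h_ge[OF ab(1) that] by (rule order.trans)
  ultimately have "is_min_value h B (f a b)"
    unfolding is_min_value_iff using ab by blast
  hence "is_minmax f A B (f a b)"
    unfolding is_minmax_def using h by blast
  with maxmin show ?thesis by (simp add: is_game_value_def)
qed

lemma is_max_value_unique:
  assumes "is_max_value f A v" "is_max_value f A w"
  shows "v = w"
  using assms unfolding is_max_value_iff by (metis order.antisym)

lemma is_min_value_unique:
  assumes "is_min_value f A v" "is_min_value f A w"
  shows "v = w"
  using assms unfolding is_min_value_iff by (metis order.antisym)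

lemma is_maxmin_unique:
  assumes "is_maxmin f A B v" "is_maxmin f A B w"
  shows "v = w"
proof -
  obtain g h where g: "\<And>a. a \<in> A \<Longrightarrow> is_min_value (f a) B (g a)" "is_max_value g A v"
    and h: "\<And>a. a \<in> A \<Longrightarrow> is_min_value (f a) B (h a)" "is_max_value h A w"
    using assms unfolding is_maxmin_def by blast
  have "g a = h a" if "a \<in> A" for a
    using g(1)[OF that] h(1)[OF that] by (rule is_min_value_unique)
  hence "is_max_value g A w"
    using h(2) by (simp add: is_max_value_iff)
  with g(2) show ?thesis by (rule is_max_value_unique)
qed

section \<open>The entropic game\<close>

lemma entropic_payoff_eq_sums:
  assumes U: "finite U" "\<sigma> \<in> prob_simplex U" and W: "finite W" "\<tau> \<in> prob_simplex W"
  shows "entropic_payoff \<beta>1 \<beta>2 \<rho> x \<sigma> \<tau> =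
    (\<Sum>u\<in>U. \<Sum>w\<in>W. pmf \<sigma> u * pmf \<tau> w * \<rho> x u w)
      - (1 / \<beta>1) * (\<Sum>u\<in>U. pmf \<sigma> u * ln (pmf \<sigma> u))
      + (1 / \<beta>2) * (\<Sum>w\<in>W. pmf \<tau> w * ln (pmf \<tau> w))"
proof -
  have "entropic_payoff \<beta>1 \<beta>2 \<rho> x \<sigma> \<tau> =
      (\<Sum>(u, w)\<in>U \<times> W. pmf (pair_pmf \<sigma> \<tau>) (u, w) *
        (\<rho> x u w - (1 / \<beta>1) * ln (pmf \<sigma> u) + (1 / \<beta>2) * ln (pmf \<tau> w)))"
    unfolding entropic_payoff_def using assms
    by (subst integral_measure_pmf[of "U \<times> W"])
       (auto simp: prob_simplex_def case_prod_unfold)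
  also have "\<dots> = (\<Sum>u\<in>U. \<Sum>w\<in>W. pmf \<sigma> u * pmf \<tau> w * \<rho> x u w
        - pmf \<tau> w * ((1 / \<beta>1) * (pmf \<sigma> u * ln (pmf \<sigma> u)))
        + pmf \<sigma> u * ((1 / \<beta>2) * (pmf \<tau> w * ln (pmf \<tau> w))))"
    unfolding sum.cartesian_product by (simp add: pmf_pair algebra_simps)
  also have "\<dots> = (\<Sum>u\<in>U. \<Sum>w\<in>W. pmf \<sigma> u * pmf \<tau> w * \<rho> x u w)
        - (\<Sum>u\<in>U. (\<Sum>w\<in>W. pmf \<tau> w) * ((1 / \<beta>1) * (pmf \<sigma> u * ln (pmf \<sigma> u))))
        + (\<Sum>u\<in>U. pmf \<sigma> u) * (\<Sum>w\<in>W. (1 / \<beta>2) * (pmf \<tau> w * ln (pmf \<tau> w)))"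
    by (simp only: sum.distrib sum_subtractf sum_distrib_left[symmetric] sum_distrib_right[symmetric])
  finally show ?thesis
    by (simp only: sum_pmf_prob_simplex assms mult_1_left sum_distrib_left[symmetric])
qed

lemma entropic_payoff_player2:
  assumes U: "finite U" "\<sigma> \<in> prob_simplex U" and W: "finite W" "\<tau> \<in> prob_simplex W"
  shows "entropic_payoff \<beta>1 \<beta>2 \<rho> x \<sigma> \<tau> =
    free_energy \<beta>2 W (\<lambda>w. \<Sum>u\<in>U. pmf \<sigma> u * \<rho> x u w) \<tau>
      - (1 / \<beta>1) * (\<Sum>u\<in>U. pmf \<sigma> u * ln (pmf \<sigma> u))"
proof -
  have "(\<Sum>u\<in>U. \<Sum>w\<in>W. pmf \<sigma> u * pmf \<tau> w * \<rho> x u w) =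
      (\<Sum>w\<in>W. pmf \<tau> w * (\<Sum>u\<in>U. pmf \<sigma> u * \<rho> x u w))"
    by (subst sum.swap) (simp add: sum_distrib_left mult_ac)
  thus ?thesis
    unfolding entropic_payoff_eq_sums[OF assms] free_energy_def by simp
qed

text \<open>Player 1 maximises; with the sign of the payoff reversed the problem is again one of
  minimising a free energy, so both players' best replies are covered by the same lemmas.\<close>

lemma entropic_payoff_player1:
  assumes U: "finite U" "\<sigma> \<in> prob_simplex U" and W: "finite W" "\<tau> \<in> prob_simplex W"
  shows "entropic_payoff \<beta>1 \<beta>2 \<rho> x \<sigma> \<tau> =
    - free_energy \<beta>1 U (\<lambda>u. - (\<Sum>w\<in>W. pmf \<tau> w * \<rho> x u w)) \<sigma>
      + (1 / \<beta>2) * (\<Sum>w\<in>W. pmf \<tau> w * ln (pmf \<tau> w))"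
proof -
  have "(\<Sum>u\<in>U. \<Sum>w\<in>W. pmf \<sigma> u * pmf \<tau> w * \<rho> x u w) =
      - (\<Sum>u\<in>U. pmf \<sigma> u * - (\<Sum>w\<in>W. pmf \<tau> w * \<rho> x u w))"
    by (simp add: sum_distrib_left mult_ac sum_negf)
  thus ?thesis
    unfolding entropic_payoff_eq_sums[OF assms] free_energy_def by simp
qed

lemma entropic_payoff_concave:
  assumes U: "finite U" "s \<in> prob_simplex U" "\<sigma> \<in> prob_simplex U" "r \<in> prob_simplex U"
    and W: "finite W" "\<tau> \<in> prob_simplex W"
    and e: "0 < e" "e < 1" and \<beta>1: "\<beta>1 > 0"
    and r: "\<And>u. pmf r u = (1 - e) * pmf s u + e * pmf \<sigma> u"
  shows "(1 - e) * entropic_payoff \<beta>1 \<beta>2 \<rho> x s \<tau> + e * entropic_payoff \<beta>1 \<beta>2 \<rho> x \<sigma> \<tau>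
    \<le> entropic_payoff \<beta>1 \<beta>2 \<rho> x r \<tau>"
proof -
  have lin: "(\<Sum>u\<in>U. \<Sum>w\<in>W. pmf r u * pmf \<tau> w * \<rho> x u w) =
      (1 - e) * (\<Sum>u\<in>U. \<Sum>w\<in>W. pmf s u * pmf \<tau> w * \<rho> x u w)
      + e * (\<Sum>u\<in>U. \<Sum>w\<in>W. pmf \<sigma> u * pmf \<tau> w * \<rho> x u w)"
    unfolding r sum_distrib_left sum.distrib[symmetric]
    by (intro sum.cong refl) (simp add: algebra_simps)
  have "(\<Sum>u\<in>U. pmf r u * ln (pmf r u)) \<le>
      (\<Sum>u\<in>U. (1 - e) * (pmf s u * ln (pmf s u)) + e * (pmf \<sigma> u * ln (pmf \<sigma> u)))"
    unfolding r using e by (intro sum_mono xlnx_convex) auto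
  also have "\<dots> = (1 - e) * (\<Sum>u\<in>U. pmf s u * ln (pmf s u)) + e * (\<Sum>u\<in>U. pmf \<sigma> u * ln (pmf \<sigma> u))"
    by (simp add: sum.distrib sum_distrib_left)
  finally have "(1 / \<beta>1) * (\<Sum>u\<in>U. pmf r u * ln (pmf r u)) \<le> (1 / \<beta>1) *
      ((1 - e) * (\<Sum>u\<in>U. pmf s u * ln (pmf s u)) + e * (\<Sum>u\<in>U. pmf \<sigma> u * ln (pmf \<sigma> u)))"
    using \<beta>1 by (intro mult_left_mono) auto
  thus ?thesis
    by (simp only: entropic_payoff_eq_sums[OF U(1,2) W] entropic_payoff_eq_sums[OF U(1,3) W]
        entropic_payoff_eq_sums[OF U(1,4) W] lin)
      (simp add: algebra_simps diff_divide_distrib)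
qed

text \<open>The argument is an arbitrary weight function rather than a distribution, so that
  continuity can be stated in the product topology.\<close>

definition guaranteed_payoff ::
    "real \<Rightarrow> real \<Rightarrow> ('x \<Rightarrow> 'u \<Rightarrow> 'w \<Rightarrow> real) \<Rightarrow> 'x \<Rightarrow> 'u set \<Rightarrow> 'w set \<Rightarrow> ('u \<Rightarrow> real) \<Rightarrow> real" where
  "guaranteed_payoff \<beta>1 \<beta>2 \<rho> x U W p =
     - (1 / \<beta>1) * (\<Sum>u\<in>U. p u * ln (p u)) + soft_min \<beta>2 W (\<lambda>w. \<Sum>u\<in>U. p u * \<rho> x u w)"

lemma continuous_on_guaranteed_payoff:
  fixes U :: "'u set"
  assumes "finite W" "W \<noteq> {}"
  shows "continuous_on {p. \<forall>u. p u \<ge> 0} (guaranteed_payoff \<beta>1 \<beta>2 \<rho> x U W)"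
proof -
  have coord: "continuous_on S (\<lambda>p. p u)" for S and u :: 'u
    by (rule continuous_on_subset[OF continuous_on_product_coordinates]) auto
  have xlnx: "continuous_on {p. \<forall>u. p u \<ge> 0} (\<lambda>p. p u * ln (p u :: real))" for u :: 'u
    by (rule continuous_on_compose2[OF continuous_on_xlnx coord]) auto
  have Z: "(\<Sum>w\<in>W. exp (- \<beta>2 * (\<Sum>u\<in>U. p u * \<rho> x u w))) \<noteq> 0" for p
    using partition_function_pos[OF assms, of \<beta>2 "\<lambda>w. \<Sum>u\<in>U. p u * \<rho> x u w"] by simp
  show ?thesis
    unfolding guaranteed_payoff_def soft_min_def
    by (intro continuous_intros xlnx coord) (use Z in auto)
qed

lemma guaranteed_payoff_le:
  assumes U: "finite U" "\<sigma> \<in> prob_simplex U" and W: "finite W" "W \<noteq> {}" "\<tau> \<in> prob_simplex W"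
    and \<beta>2: "\<beta>2 > 0"
  shows "guaranteed_payoff \<beta>1 \<beta>2 \<rho> x U W (pmf \<sigma>) \<le> entropic_payoff \<beta>1 \<beta>2 \<rho> x \<sigma> \<tau>"
  unfolding entropic_payoff_player2[OF U W(1,3)] guaranteed_payoff_def
  using free_energy_ge_soft_min[OF W(1,2) \<beta>2 W(3)] by simp

lemma boltzmann_reply:
  assumes U: "finite U" "\<sigma> \<in> prob_simplex U" and W: "finite W" "W \<noteq> {}" and \<beta>2: "\<beta>2 > 0"
  obtains \<tau> where "\<tau> \<in> prob_simplex W"
    "\<forall>w\<in>W. pmf \<tau> w = boltzmann \<beta>2 W (\<lambda>w. \<Sum>u\<in>U. pmf \<sigma> u * \<rho> x u w) w"
    "entropic_payoff \<beta>1 \<beta>2 \<rho> x \<sigma> \<tau> = guaranteed_payoff \<beta>1 \<beta>2 \<rho> x U W (pmf \<sigma>)"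
proof -
  let ?c = "\<lambda>w. \<Sum>u\<in>U. pmf \<sigma> u * \<rho> x u w"
  obtain \<tau> where \<tau>: "\<tau> \<in> prob_simplex W" "\<forall>w\<in>W. pmf \<tau> w = boltzmann \<beta>2 W ?c w"
    and attains: "free_energy \<beta>2 W ?c \<tau> = soft_min \<beta>2 W ?c"
    using boltzmann_attains_soft_min[OF W \<beta>2, of ?c] by blast
  have "entropic_payoff \<beta>1 \<beta>2 \<rho> x \<sigma> \<tau> = guaranteed_payoff \<beta>1 \<beta>2 \<rho> x U W (pmf \<sigma>)"
    by (simp add: entropic_payoff_player2[OF U W(1) \<tau>(1)] guaranteed_payoff_def attains)
  with \<tau> show thesis by (rule that)
qed

lemma entropic_payoff_attains_min:
  assumes U: "finite U" "\<sigma> \<in> prob_simplex U" and W: "finite W" "W \<noteq> {}" and \<beta>2: "\<beta>2 > 0"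
  shows "\<exists>v. is_min_value (entropic_payoff \<beta>1 \<beta>2 \<rho> x \<sigma>) (prob_simplex W) v"
proof -
  obtain \<tau> where "\<tau> \<in> prob_simplex W"
    "entropic_payoff \<beta>1 \<beta>2 \<rho> x \<sigma> \<tau> = guaranteed_payoff \<beta>1 \<beta>2 \<rho> x U W (pmf \<sigma>)"
    using boltzmann_reply[OF U W \<beta>2, of \<rho> x \<beta>1] by blast
  thus ?thesis
    using guaranteed_payoff_le[OF U W _ \<beta>2, of _ \<beta>1 \<rho> x]
    unfolding is_min_value_iff by metis
qed

lemma entropic_payoff_attains_max:
  assumes U: "finite U" "U \<noteq> {}" and W: "finite W" "\<tau> \<in> prob_simplex W" and \<beta>1: "\<beta>1 > 0"
  shows "\<exists>v. is_max_value (\<lambda>\<sigma>. entropic_payoff \<beta>1 \<beta>2 \<rho> x \<sigma> \<tau>) (prob_simplex U) v"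
proof -
  let ?c = "\<lambda>u. - (\<Sum>w\<in>W. pmf \<tau> w * \<rho> x u w)"
  obtain \<sigma> where \<sigma>: "\<sigma> \<in> prob_simplex U" "free_energy \<beta>1 U ?c \<sigma> = soft_min \<beta>1 U ?c"
    using boltzmann_attains_soft_min[OF U \<beta>1, of ?c] by blast
  have "entropic_payoff \<beta>1 \<beta>2 \<rho> x s \<tau> \<le> entropic_payoff \<beta>1 \<beta>2 \<rho> x \<sigma> \<tau>" if "s \<in> prob_simplex U" for s
    unfolding entropic_payoff_player1[OF U(1) that W] entropic_payoff_player1[OF U(1) \<sigma>(1) W]
    using free_energy_ge_soft_min[OF U \<beta>1 that, of ?c] \<sigma>(2) by simp
  with \<sigma>(1) show ?thesis
    unfolding is_max_value_iff by blast
qed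

text \<open>If the maximiser \<open>s\<close> of the guaranteed payoff moves a little towards \<open>\<sigma>\<close>, the reply of
  player 2 moves only a little, while concavity bounds what \<open>\<sigma>\<close> earns against that reply.\<close>

lemma no_profitable_deviation:
  assumes U: "finite U" and W: "finite W" "W \<noteq> {}" and \<beta>: "\<beta>1 > 0" "\<beta>2 > 0"
    and s: "s \<in> prob_simplex U" and \<sigma>: "\<sigma> \<in> prob_simplex U" and t: "t \<in> prob_simplex W"
    and s_max: "\<forall>r\<in>prob_simplex U.
      guaranteed_payoff \<beta>1 \<beta>2 \<rho> x U W (pmf r) \<le> guaranteed_payoff \<beta>1 \<beta>2 \<rho> x U W (pmf s)"
    and t_reply: "\<forall>w\<in>W. pmf t w = boltzmann \<beta>2 W (\<lambda>w. \<Sum>u\<in>U. pmf s u * \<rho> x u w) w"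
  shows "entropic_payoff \<beta>1 \<beta>2 \<rho> x \<sigma> t \<le> guaranteed_payoff \<beta>1 \<beta>2 \<rho> x U W (pmf s)"
proof -
  let ?V = "entropic_payoff \<beta>1 \<beta>2 \<rho> x" and ?G = "\<lambda>s. guaranteed_payoff \<beta>1 \<beta>2 \<rho> x U W (pmf s)"
  define c where "c = (\<lambda>e w. \<Sum>u\<in>U. ((1 - e) * pmf s u + e * pmf \<sigma> u) * \<rho> x u w)"
  define q where "q = (\<lambda>e. boltzmann \<beta>2 W (c e))"
  define H where "H = (1 / \<beta>1) * (\<Sum>u\<in>U. pmf \<sigma> u * ln (pmf \<sigma> u))"
  define d where "d = (\<lambda>w. \<Sum>u\<in>U. pmf \<sigma> u * \<rho> x u w)"
  \<comment> \<open>The payoff of \<open>\<sigma>\<close> against the reply to the mixture with weight \<open>e\<close>.\<close>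
  define \<phi> where
    "\<phi> = (\<lambda>e. (\<Sum>w\<in>W. q e w * d w) + (1 / \<beta>2) * (\<Sum>w\<in>W. q e w * ln (q e w)) - H)"
  have bound: "\<phi> e \<le> ?G s" if e: "0 < e" "e < 1" for e
  proof -
    obtain r where r: "r \<in> prob_simplex U" "\<forall>u. pmf r u = (1 - e) * pmf s u + e * pmf \<sigma> u"
      using prob_simplex_mixture[OF s \<sigma> less_imp_le[OF e(1)] less_imp_le[OF e(2)]] by blast
    obtain t' where t': "t' \<in> prob_simplex W"
      "\<forall>w\<in>W. pmf t' w = boltzmann \<beta>2 W (\<lambda>w. \<Sum>u\<in>U. pmf r u * \<rho> x u w) w"
      "?V r t' = ?G r"
      using boltzmann_reply[OF U r(1) W \<beta>(2), of \<rho> x \<beta>1] by blast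
    have "pmf t' w = q e w" if "w \<in> W" for w
      using bspec[OF t'(2) that] by (simp add: q_def c_def r(2))
    hence V: "?V \<sigma> t' = \<phi> e"
      using entropic_payoff_player2[OF U \<sigma> W(1) t'(1)]
      by (simp add: \<phi>_def free_energy_def d_def H_def)
    have "(1 - e) * ?G s + e * \<phi> e \<le> (1 - e) * ?V s t' + e * ?V \<sigma> t'"
      unfolding V using guaranteed_payoff_le[OF U s W t'(1) \<beta>(2)] e
      by (intro add_mono mult_left_mono) auto
    also have "\<dots> \<le> ?V r t'"
      by (rule entropic_payoff_concave[OF U s \<sigma> r(1) W(1) t'(1) e \<beta>(1) spec[OF r(2)]])
    also have "\<dots> \<le> ?G s"
      unfolding t'(3) by (rule bspec[OF s_max r(1)])
    finally have "e * \<phi> e \<le> e * ?G s" by (simp add: algebra_simps)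
    thus ?thesis using e by simp
  qed
  have q0: "q 0 w = pmf t w" if "w \<in> W" for w
    using bspec[OF t_reply that] by (simp add: q_def c_def)
  have "((\<lambda>e. c e w) \<longlongrightarrow> c 0 w) (at_right 0)" for w
    unfolding c_def by (intro tendsto_intros)
  hence "((\<lambda>e. q e w) \<longlongrightarrow> q 0 w) (at_right 0)" for w
    unfolding q_def by (intro tendsto_boltzmann W)
  moreover have "q 0 w \<noteq> 0" for w
    using boltzmann_pos[OF W, of \<beta>2 "c 0" w] by (simp add: q_def)
  ultimately have "(\<phi> \<longlongrightarrow> \<phi> 0) (at_right 0)"
    unfolding \<phi>_def by (intro tendsto_intros) auto
  moreover have "\<forall>\<^sub>F e in at_right 0. \<phi> e \<le> ?G s"
    using bound by (auto simp: eventually_at_right_field intro!: exI[of _ 1])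
  ultimately have "\<phi> 0 \<le> ?G s"
    by (intro tendsto_upperbound) auto
  moreover have "?V \<sigma> t = \<phi> 0"
    using entropic_payoff_player2[OF U \<sigma> W(1) t]
    by (simp add: \<phi>_def free_energy_def d_def H_def q0)
  ultimately show ?thesis by simp
qed

lemma ex_saddle_point:
  assumes U: "finite U" "U \<noteq> {}" and W: "finite W" "W \<noteq> {}" and \<beta>: "\<beta>1 > 0" "\<beta>2 > 0"
  shows "\<exists>\<sigma> \<tau>. saddle_point (entropic_payoff \<beta>1 \<beta>2 \<rho> x) (prob_simplex U) (prob_simplex W) \<sigma> \<tau>"
proof -
  obtain s where s: "s \<in> prob_simplex U"
    and s_max: "\<forall>r\<in>prob_simplex U.
      guaranteed_payoff \<beta>1 \<beta>2 \<rho> x U W (pmf r) \<le> guaranteed_payoff \<beta>1 \<beta>2 \<rho> x U W (pmf s)"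
    using continuous_attains_max_prob_simplex[OF U continuous_on_guaranteed_payoff[OF W, of \<beta>1 \<beta>2 \<rho> x U]] by blast
  obtain t where t: "t \<in> prob_simplex W"
    "\<forall>w\<in>W. pmf t w = boltzmann \<beta>2 W (\<lambda>w. \<Sum>u\<in>U. pmf s u * \<rho> x u w) w"
    "entropic_payoff \<beta>1 \<beta>2 \<rho> x s t = guaranteed_payoff \<beta>1 \<beta>2 \<rho> x U W (pmf s)"
    using boltzmann_reply[OF U(1) s W \<beta>(2), of \<rho> x \<beta>1] by blast
  have "saddle_point (entropic_payoff \<beta>1 \<beta>2 \<rho> x) (prob_simplex U) (prob_simplex W) s t"
    unfolding saddle_point_def
    using s t no_profitable_deviation[OF U(1) W \<beta> s _ t(1) s_max t(2)]
      guaranteed_payoff_le[OF U(1) s W _ \<beta>(2)] by auto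
  thus ?thesis by blast
qed

text \<open>At a saddle point player 2 plays a best reply, and the Boltzmann distribution is the only one.
  Any other \<open>s\<close> guarantees at most what it earns against \<open>\<tau>\<close>, hence at most the saddle value.\<close>

lemma saddle_point_properties:
  assumes U: "finite U" and W: "finite W" "W \<noteq> {}" and \<beta>2: "\<beta>2 > 0"
    and sp: "saddle_point (entropic_payoff \<beta>1 \<beta>2 \<rho> x) (prob_simplex U) (prob_simplex W) \<sigma> \<tau>"
  shows "entropic_payoff \<beta>1 \<beta>2 \<rho> x \<sigma> \<tau> = guaranteed_payoff \<beta>1 \<beta>2 \<rho> x U W (pmf \<sigma>)"
    and "is_arg_max (\<lambda>s. guaranteed_payoff \<beta>1 \<beta>2 \<rho> x U W (pmf s)) (\<lambda>s. s \<in> prob_simplex U) \<sigma>"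
    and "\<forall>w\<in>W. pmf \<tau> w = boltzmann \<beta>2 W (\<lambda>w. \<Sum>u\<in>U. pmf \<sigma> u * \<rho> x u w) w"
proof -
  let ?V = "entropic_payoff \<beta>1 \<beta>2 \<rho> x" and ?G = "\<lambda>s. guaranteed_payoff \<beta>1 \<beta>2 \<rho> x U W (pmf s)"
  have \<sigma>: "\<sigma> \<in> prob_simplex U" and \<tau>: "\<tau> \<in> prob_simplex W"
    and \<sigma>_best: "\<And>s. s \<in> prob_simplex U \<Longrightarrow> ?V s \<tau> \<le> ?V \<sigma> \<tau>"
    and \<tau>_best: "\<And>t. t \<in> prob_simplex W \<Longrightarrow> ?V \<sigma> \<tau> \<le> ?V \<sigma> t"
    using sp by (auto simp: saddle_point_def)
  obtain t where t: "t \<in> prob_simplex W" "?V \<sigma> t = ?G \<sigma>"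
    using boltzmann_reply[OF U \<sigma> W \<beta>2, of \<rho> x \<beta>1] by blast
  show eq: "?V \<sigma> \<tau> = ?G \<sigma>"
    using \<tau>_best[OF t(1)] guaranteed_payoff_le[OF U \<sigma> W \<tau> \<beta>2, of \<beta>1 \<rho> x]
    unfolding t(2) by (rule antisym)
  have "?G s \<le> ?G \<sigma>" if "s \<in> prob_simplex U" for s
    using guaranteed_payoff_le[OF U that W \<tau> \<beta>2] \<sigma>_best[OF that]
    unfolding eq by (rule order.trans)
  with \<sigma> show "is_arg_max ?G (\<lambda>s. s \<in> prob_simplex U) \<sigma>"
    unfolding is_arg_max_def not_less[symmetric] by blast
  have "free_energy \<beta>2 W (\<lambda>w. \<Sum>u\<in>U. pmf \<sigma> u * \<rho> x u w) \<tau>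
      = soft_min \<beta>2 W (\<lambda>w. \<Sum>u\<in>U. pmf \<sigma> u * \<rho> x u w)"
    using eq entropic_payoff_player2[OF U \<sigma> W(1) \<tau>, of \<beta>1 \<beta>2 \<rho> x]
    by (simp add: guaranteed_payoff_def)
  thus "\<forall>w\<in>W. pmf \<tau> w = boltzmann \<beta>2 W (\<lambda>w. \<Sum>u\<in>U. pmf \<sigma> u * \<rho> x u w) w"
    using free_energy_eq_imp_boltzmann[OF W \<beta>2 \<tau>] by blast
qed

theorem proposition3:
  fixes X :: "'x set" and U :: "'u set" and W :: "'w set"
    and \<beta>1 \<beta>2 :: real and \<rho> :: "'x \<Rightarrow> 'u \<Rightarrow> 'w \<Rightarrow> real" and x :: 'x
  assumes "finite X" and "X \<noteq> {}"
    and "finite U" and "U \<noteq> {}"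
    and "finite W" and "W \<noteq> {}"
    and "\<beta>1 > 0" and "\<beta>2 > 0"
    and "x \<in> X"
  shows
    "(\<exists>\<sigma> \<tau>. saddle_point (entropic_payoff \<beta>1 \<beta>2 \<rho> x) (prob_simplex U) (prob_simplex W) \<sigma> \<tau>) \<and>
     (\<exists>!v. is_game_value (entropic_payoff \<beta>1 \<beta>2 \<rho> x) (prob_simplex U) (prob_simplex W) v) \<and>
     (\<forall>\<sigma> \<tau>. saddle_point (entropic_payoff \<beta>1 \<beta>2 \<rho> x) (prob_simplex U) (prob_simplex W) \<sigma> \<tau> \<longrightarrow>
        is_arg_max
          (\<lambda>s. - (1 / \<beta>1) * (\<Sum>u\<in>U. pmf s u * ln (pmf s u))
               - (1 / \<beta>2) * ln (\<Sum>w\<in>W. exp (- \<beta>2 * (\<Sum>u\<in>U. pmf s u * \<rho> x u w))))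
          (\<lambda>s. s \<in> prob_simplex U) \<sigma> \<and>
        (\<forall>w\<in>W. pmf \<tau> w =
           exp (- \<beta>2 * (\<Sum>u\<in>U. pmf \<sigma> u * \<rho> x u w)) /
           (\<Sum>w'\<in>W. exp (- \<beta>2 * (\<Sum>u\<in>U. pmf \<sigma> u * \<rho> x u w')))) \<and>
        is_game_value (entropic_payoff \<beta>1 \<beta>2 \<rho> x) (prob_simplex U) (prob_simplex W)
          (- (1 / \<beta>1) * (\<Sum>u\<in>U. pmf \<sigma> u * ln (pmf \<sigma> u))
           - (1 / \<beta>2) * ln (\<Sum>w\<in>W. exp (- \<beta>2 * (\<Sum>u\<in>U. pmf \<sigma> u * \<rho> x u w)))))"
proof -
  let ?V = "entropic_payoff \<beta>1 \<beta>2 \<rho> x" and ?G = "\<lambda>s. guaranteed_payoff \<beta>1 \<beta>2 \<rho> x U W (pmf s)"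
  let ?S = "prob_simplex U" and ?T = "prob_simplex W"
  note U = \<open>finite U\<close> \<open>U \<noteq> {}\<close> and W = \<open>finite W\<close> \<open>W \<noteq> {}\<close> and \<beta> = \<open>\<beta>1 > 0\<close> \<open>\<beta>2 > 0\<close>
  have G_eq: "- (1 / \<beta>1) * (\<Sum>u\<in>U. pmf s u * ln (pmf s u))
      - (1 / \<beta>2) * ln (\<Sum>w\<in>W. exp (- \<beta>2 * (\<Sum>u\<in>U. pmf s u * \<rho> x u w))) = ?G s" for s
    by (simp add: guaranteed_payoff_def soft_min_def)
  have game_value: "is_game_value ?V ?S ?T (?V \<sigma> \<tau>)" if "saddle_point ?V ?S ?T \<sigma> \<tau>" for \<sigma> \<tau>
    using that entropic_payoff_attains_min[OF U(1) _ W \<beta>(2)]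
      entropic_payoff_attains_max[OF U W(1) _ \<beta>(1)]
    by (rule saddle_point_imp_game_value)
  have ex: "\<exists>\<sigma> \<tau>. saddle_point ?V ?S ?T \<sigma> \<tau>"
    by (rule ex_saddle_point[OF U W \<beta>])
  then obtain \<sigma> \<tau> where sp: "saddle_point ?V ?S ?T \<sigma> \<tau>" by blast
  have value_unique: "\<exists>!v. is_game_value ?V ?S ?T v"
  proof (rule ex1I[of _ "?V \<sigma> \<tau>"])
    show "is_game_value ?V ?S ?T (?V \<sigma> \<tau>)" by (rule game_value[OF sp])
    show "v = ?V \<sigma> \<tau>" if "is_game_value ?V ?S ?T v" for v
      using that game_value[OF sp] unfolding is_game_value_def by (blast intro: is_maxmin_unique)
  qed
  have saddle: "is_arg_max ?G (\<lambda>s. s \<in> ?S) \<sigma> \<and>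
      (\<forall>w\<in>W. pmf \<tau> w = exp (- \<beta>2 * (\<Sum>u\<in>U. pmf \<sigma> u * \<rho> x u w)) /
         (\<Sum>w'\<in>W. exp (- \<beta>2 * (\<Sum>u\<in>U. pmf \<sigma> u * \<rho> x u w')))) \<and>
      is_game_value ?V ?S ?T (?G \<sigma>)" if "saddle_point ?V ?S ?T \<sigma> \<tau>" for \<sigma> \<tau>
    using saddle_point_properties(2,3)[OF U(1) W \<beta>(2) that] game_value[OF that]
    unfolding boltzmann_def saddle_point_properties(1)[OF U(1) W \<beta>(2) that] by blast
  show ?thesis
    unfolding G_eq by (intro conjI[OF ex] conjI[OF value_unique] allI impI saddle)
qed

end
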